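(* For the two-user SGUM based power control game, each user's SNE strategy decreases when its social tie with the other user increases: for $\{i,j\}=\{1,2\}$, with all other parameters fixed, $p_i^{SNE}$ is a decreasing function of $w_{ij}\in[0,1]$.
   Context: Two users $i\in\{1,2\}$; user $i$ is a link with transmitter $T_i$ and receiver $R_i$, and chooses a transmit power $p_i\in(0,\infty)$. $h_i>0$ is the channel gain of link $i$, $g_{ij}>0$ ($i\ne j$) is the gain of the interference link from $T_i$ to $R_j$, $n_i>0$ is the noise at $R_i$, $c_i>0$ is the cost per unit power, and $w_{ij}\in[0,1]$ is the strength of user $i$'s social tie towards user $j$. For $j\neq i$: the SINR of link $i$ is $\gamma_i=\dfrac{h_ip_i}{n_i+g_{ji}p_j}$; individual utility $U_i=\log(\gamma_i)-c_ip_i$; social group utility $S_i=U_i+w_{ij}U_j$. In the SGUM based power control game, user $i$ chooses $p_i$ to maximize $S_i$. The socially-aware Nash equilibrium (SNE) is the profile in which each $p_i$ maximizes $S_i$ given the other's power; it is unique and given, for $\{i,j\}=\{1,2\}$, by $p_i^{SNE}=\sqrt{\alpha_i^2+\beta_i}-\alpha_i$ with $\alpha_i=\dfrac{w_{ij}g_{ij}+c_in_j-g_{ij}}{2c_ig_{ij}}$ and $\beta_i=\dfrac{n_j}{c_ig_{ij}}$. *)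

theory Defs
  imports Complex_Main
begin

datatype user = User1 | User2

primrec other :: "user \<Rightarrow> user" where
  "other User1 = User2"
| "other User2 = User1"

text \<open>
  \<open>h i\<close>, \<open>n i\<close>, \<open>c i\<close>: channel gain, noise and unit power cost of link \<open>i\<close>;
  \<open>g i j\<close>: interference gain from the transmitter of \<open>i\<close> to the receiver of \<open>j\<close>;
  \<open>w i j\<close>: strength of the social tie of \<open>i\<close> towards \<open>j\<close>; \<open>p i\<close>: transmit power of \<open>i\<close>.
  The diagonal values of \<open>g\<close> and \<open>w\<close> are never used and are left unconstrained.
\<close>

locale power_control_game =
  fixes h :: "user \<Rightarrow> real" and g :: "user \<Rightarrow> user \<Rightarrow> real"
    and n c :: "user \<Rightarrow> real" and w :: "user \<Rightarrow> user \<Rightarrow> real"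
  assumes h_pos: "0 < h i"
    and g_pos: "i \<noteq> j \<Longrightarrow> 0 < g i j"
    and n_pos: "0 < n i"
    and c_pos: "0 < c i"
    and w_range: "i \<noteq> j \<Longrightarrow> w i j \<in> {0..1}"

definition sinr ::
  "(user \<Rightarrow> real) \<Rightarrow> (user \<Rightarrow> user \<Rightarrow> real) \<Rightarrow> (user \<Rightarrow> real) \<Rightarrow> (user \<Rightarrow> real) \<Rightarrow> user \<Rightarrow> real"
  where "sinr h g n p i = h i * p i / (n i + g (other i) i * p (other i))"

definition individual_utility ::
  "(user \<Rightarrow> real) \<Rightarrow> (user \<Rightarrow> user \<Rightarrow> real) \<Rightarrow> (user \<Rightarrow> real) \<Rightarrow> (user \<Rightarrow> real) \<Rightarrow> (user \<Rightarrow> real)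
    \<Rightarrow> user \<Rightarrow> real"
  where "individual_utility h g n c p i = ln (sinr h g n p i) - c i * p i"

definition social_group_utility ::
  "(user \<Rightarrow> real) \<Rightarrow> (user \<Rightarrow> user \<Rightarrow> real) \<Rightarrow> (user \<Rightarrow> real) \<Rightarrow> (user \<Rightarrow> real)
    \<Rightarrow> (user \<Rightarrow> user \<Rightarrow> real) \<Rightarrow> (user \<Rightarrow> real) \<Rightarrow> user \<Rightarrow> real"
  where "social_group_utility h g n c w p i =
    individual_utility h g n c p i + w i (other i) * individual_utility h g n c p (other i)"

definition is_SNE ::
  "(user \<Rightarrow> real) \<Rightarrow> (user \<Rightarrow> user \<Rightarrow> real) \<Rightarrow> (user \<Rightarrow> real) \<Rightarrow> (user \<Rightarrow> real)
    \<Rightarrow> (user \<Rightarrow> user \<Rightarrow> real) \<Rightarrow> (user \<Rightarrow> real) \<Rightarrow> bool"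
  where "is_SNE h g n c w p \<longleftrightarrow>
    (\<forall>i. is_arg_max (\<lambda>x. social_group_utility h g n c w (p(i := x)) i) (\<lambda>x. 0 < x) (p i))"

definition SNE ::
  "(user \<Rightarrow> real) \<Rightarrow> (user \<Rightarrow> user \<Rightarrow> real) \<Rightarrow> (user \<Rightarrow> real) \<Rightarrow> (user \<Rightarrow> real)
    \<Rightarrow> (user \<Rightarrow> user \<Rightarrow> real) \<Rightarrow> user \<Rightarrow> real"
  where "SNE h g n c w = (THE p. is_SNE h g n c w p)"

text \<open>
  The equilibrium exists, is unique and is given by the following closed form, so the description
  in the definition of \<open>SNE\<close> is proper.
\<close>

definition sne_alpha ::
  "(user \<Rightarrow> user \<Rightarrow> real) \<Rightarrow> (user \<Rightarrow> real) \<Rightarrow> (user \<Rightarrow> real) \<Rightarrow> (user \<Rightarrow> user \<Rightarrow> real)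
    \<Rightarrow> user \<Rightarrow> real"
  where "sne_alpha g n c w i =
    (w i (other i) * g i (other i) + c i * n (other i) - g i (other i))
      / (2 * c i * g i (other i))"

definition sne_beta ::
  "(user \<Rightarrow> user \<Rightarrow> real) \<Rightarrow> (user \<Rightarrow> real) \<Rightarrow> (user \<Rightarrow> real) \<Rightarrow> user \<Rightarrow> real"
  where "sne_beta g n c i = n (other i) / (c i * g i (other i))"

definition sne_power ::
  "(user \<Rightarrow> user \<Rightarrow> real) \<Rightarrow> (user \<Rightarrow> real) \<Rightarrow> (user \<Rightarrow> real) \<Rightarrow> (user \<Rightarrow> user \<Rightarrow> real)
    \<Rightarrow> user \<Rightarrow> real"
  where "sne_power g n c w i =
    sqrt ((sne_alpha g n c w i)\<^sup>2 + sne_beta g n c i) - sne_alpha g n c w i"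

lemma other_neq [simp]: "other i \<noteq> i" "i \<noteq> other i"
  by (cases i; simp)+

lemma other_other [simp]: "other (other i) = i"
  by (cases i) simp_all

lemma strict_maximum:
  fixes N G C W x y :: real
  assumes pos: "0 < N" "0 < G" "0 < x" "0 < y" and W: "0 \<le> W" "W \<le> 1"
    and foc: "1 / y - C - W * G / (N + G * y) = 0" and "x \<noteq> y"
  shows "ln x - C * x - W * ln (N + G * x) < ln y - C * y - W * ln (N + G * y)"
proof -
  define u v t where "u = x / y" and "v = (N + G * x) / (N + G * y)" and "t = G * y / (N + G * y)"
  have Np: "0 < N + G * x" "0 < N + G * y" using pos by (simp_all add: add_pos_pos)
  have u: "0 < u" "u \<noteq> 1" and v: "0 < v" using pos Np \<open>x \<noteq> y\<close> by (simp_all add: u_def v_def)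
  have t: "0 < t" "t < 1" using pos Np by (simp_all add: t_def)
  have uv: "u - v = (1 - t) * (u - 1)"
    using pos Np unfolding u_def v_def t_def by (simp add: field_simps)
  have Cy: "C * y = 1 - W * t"
  proof -
    have "C = 1 / y - W * G / (N + G * y)" using foc by simp
    then have "C * y = (1 / y - W * G / (N + G * y)) * y" by simp
    then show ?thesis using pos unfolding t_def by (simp add: left_diff_distrib)
  qed
  have "C * x - C * y = (C * y) * (u - 1)" using pos by (simp add: u_def field_simps)
  then have Cx: "C * x - C * y = (1 - W * t) * (u - 1)" using Cy by simp
  have uv1: "u / v \<noteq> 1"
  proof
    assume "u / v = 1"
    then have "(1 - t) * (u - 1) = 0" using uv v by simp
    then show False using t u by simp
  qed
  have l1: "ln u < u - 1" using ln_le_minus_one[of u] ln_eq_minus_one[of u] u by fastforce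
  have l2: "ln (u / v) < u / v - 1"
    using ln_le_minus_one[of "u / v"] ln_eq_minus_one[of "u / v"] u v uv1 by fastforce
  have bnd: "(1 - W) * ln u + W * ln (u / v) < (1 - W) * (u - 1) + W * (u / v - 1)"
  proof (cases "W = 1")
    case True
    then show ?thesis using l2 by simp
  next
    case False
    then have "(1 - W) * ln u < (1 - W) * (u - 1)" using W l1 by (intro mult_strict_left_mono) auto
    moreover have "W * ln (u / v) \<le> W * (u / v - 1)" using W l2 by (intro mult_left_mono) auto
    ultimately show ?thesis by linarith
  qed
  have v1: "v - 1 = t * (u - 1)" using uv by (simp add: algebra_simps)
  have "(u / v - 1) - (1 - t) * (u - 1) = (u - v) / v - (1 - t) * (u - 1)"
    using v by (simp add: diff_divide_distrib)
  also have "\<dots> = - ((1 - t) * (u - 1) * (v - 1) / v)"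
    unfolding uv using v by (simp add: field_simps)
  also have "\<dots> = - (t * (1 - t) * (u - 1)\<^sup>2 / v)"
    unfolding v1 by (simp add: power2_eq_square mult_ac)
  finally have "(u / v - 1) - (1 - t) * (u - 1) = - (t * (1 - t) * (u - 1)\<^sup>2 / v)" .
  moreover have "0 \<le> t * (1 - t) * (u - 1)\<^sup>2 / v" using t v by simp
  ultimately have "(u / v - 1) \<le> (1 - t) * (u - 1)" by linarith
  then have "W * (u / v - 1) \<le> W * ((1 - t) * (u - 1))" using W by (intro mult_left_mono)
  moreover have "(1 - W) * (u - 1) + W * ((1 - t) * (u - 1)) = (1 - W * t) * (u - 1)"
    by (simp add: algebra_simps)
  ultimately have "(1 - W) * ln u + W * ln (u / v) < C * x - C * y" using bnd Cx by linarith
  moreover have "ln (u / v) = ln u - ln v" using u v by (simp add: ln_div)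
  moreover have "ln u = ln x - ln y" using pos by (simp add: u_def ln_div)
  moreover have "ln v = ln (N + G * x) - ln (N + G * y)" using Np by (simp add: v_def ln_div)
  ultimately show ?thesis by (simp add: algebra_simps)
qed

lemma first_order:
  fixes N G C W :: real
  assumes pos: "0 < N" "0 < G" "0 < C"
  defines "a \<equiv> (W * G + C * N - G) / (2 * C * G)"
  defines "y \<equiv> sqrt (a\<^sup>2 + N / (C * G)) - a"
  shows "0 < y" "1 / y - C - W * G / (N + G * y) = 0"
proof -
  have b: "0 < N / (C * G)" using pos by simp
  have "\<bar>a\<bar> < sqrt (a\<^sup>2 + N / (C * G))" using b by (intro real_less_rsqrt) simp
  then show y: "0 < y" unfolding y_def by linarith
  have "(y + a)\<^sup>2 = a\<^sup>2 + N / (C * G)" using b unfolding y_def by simp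
  then have "y\<^sup>2 + 2 * a * y = N / (C * G)" by (simp add: power2_eq_square algebra_simps)
  then have "C * G * (y\<^sup>2 + 2 * a * y) = N" using pos by simp
  moreover have "2 * a * (C * G) = W * G + C * N - G" using pos unfolding a_def by simp
  then have "C * G * (y\<^sup>2 + 2 * a * y) = C * G * y\<^sup>2 + (W * G + C * N - G) * y"
    by (metis (no_types, opaque_lifting) distrib_left mult.commute mult.left_commute)
  ultimately have q: "C * G * y\<^sup>2 + (W * G + C * N - G) * y = N" by simp
  have "0 < N + G * y" using pos y by (simp add: add_pos_pos)
  then show "1 / y - C - W * G / (N + G * y) = 0"
    using y q by (simp add: field_simps power2_eq_square)
qed

context power_control_game
begin

lemma utility_less_iff:
  assumes "0 < p (other i)" "0 < x" "0 < y"
  shows "social_group_utility h g n c w (p(i := x)) i < social_group_utility h g n c w (p(i := y)) i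
    \<longleftrightarrow> ln x - c i * x - w i (other i) * ln (n (other i) + g i (other i) * x)
      < ln y - c i * y - w i (other i) * ln (n (other i) + g i (other i) * y)"
proof -
  have "0 < n i + g (other i) i * p (other i)"
    using assms n_pos g_pos by (simp add: add_pos_pos)
  moreover have "0 < n (other i) + g i (other i) * x" "0 < n (other i) + g i (other i) * y"
    using assms n_pos g_pos by (simp_all add: add_pos_pos)
  ultimately show ?thesis
    using assms h_pos[of i] h_pos[of "other i"]
    by (simp add: social_group_utility_def individual_utility_def sinr_def ln_div ln_mult
        distrib_left right_diff_distrib) linarith
qed

lemma best_response_iff:
  assumes "0 < p (other i)"
  shows "is_arg_max (\<lambda>x. social_group_utility h g n c w (p(i := x)) i) (\<lambda>x. 0 < x) z
    \<longleftrightarrow> z = sne_power g n c w i"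
proof -
  let ?y = "sne_power g n c w i"
  have y: "0 < ?y" "1 / ?y - c i - w i (other i) * g i (other i) / (n (other i) + g i (other i) * ?y) = 0"
    using first_order[of "n (other i)" "g i (other i)" "c i" "w i (other i)"] n_pos g_pos c_pos
    unfolding sne_power_def sne_alpha_def sne_beta_def by auto
  have "social_group_utility h g n c w (p(i := x)) i < social_group_utility h g n c w (p(i := ?y)) i"
    if "0 < x" "x \<noteq> ?y" for x
    using strict_maximum[of "n (other i)" "g i (other i)" x ?y "w i (other i)" "c i"]
      that y n_pos g_pos w_range[of i "other i"] utility_less_iff[where p = p and i = i, OF assms] by auto
  then show ?thesis using y(1) unfolding is_arg_max_def by (metis less_asym less_irrefl)
qed

lemma is_SNE_iff: "is_SNE h g n c w p \<longleftrightarrow> p = sne_power g n c w"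
proof
  assume *: "is_SNE h g n c w p"
  then have "0 < p i" for i by (auto simp: is_SNE_def is_arg_max_def)
  then show "p = sne_power g n c w" using * best_response_iff unfolding is_SNE_def by blast
next
  assume *: "p = sne_power g n c w"
  have "0 < p i" for i
    using first_order(1)[of "n (other i)" "g i (other i)" "c i" "w i (other i)"] n_pos g_pos c_pos
    unfolding * sne_power_def sne_alpha_def sne_beta_def by auto
  then show "is_SNE h g n c w p" using * best_response_iff unfolding is_SNE_def by blast
qed

lemma ex1_SNE: "\<exists>!p. is_SNE h g n c w p"
  by (simp add: is_SNE_iff)

lemma SNE_eq: "SNE h g n c w = sne_power g n c w"
  by (simp add: SNE_def is_SNE_iff)

end

end

theory Submission
  imports Defs
begin

text \<open>By the closed form \<open>SNE_eq\<close>, the tie of user \<open>i\<close> towards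
  \<open>j\<close> enters the equilibrium power of \<open>i\<close> only through
  \<open>sne_alpha\<close>, which increases with it, while \<open>sne_beta\<close> is positive and
  does not depend on it. For b > 0 the map a -> sqrt(a^2 + b) - a is strictly decreasing: its slope
  a / sqrt(a^2 + b) - 1 is negative because |a| < sqrt(a^2 + b). The proof below uses this
  inequality without derivatives.\<close>

lemma sqrt_square_plus_minus_strict_antimono:
  fixes a a' b :: real
  assumes "0 < b" "a < a'"
  shows "sqrt (a'\<^sup>2 + b) - a' < sqrt (a\<^sup>2 + b) - a"
proof -
  define s where "s = sqrt (a\<^sup>2 + b)"
  have s2: "s\<^sup>2 = a\<^sup>2 + b"
    using assms by (simp add: s_def)
  have "\<bar>a\<bar> < s"
    unfolding s_def using assms by (intro real_less_rsqrt) simp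
  then have "a < s" "0 < s"
    by linarith+
  then have "a * (a' - a) < s * (a' - a)"
    using assms by simp
  \<comment> \<open>With d = a' - a, the right side exceeds the left by 2 d (s - a).\<close>
  then have "a'\<^sup>2 + b < (s + (a' - a))\<^sup>2"
    using s2 by (simp add: power2_eq_square algebra_simps)
  then have "sqrt (a'\<^sup>2 + b) < s + (a' - a)"
    using \<open>0 < s\<close> assms by (intro real_less_lsqrt) auto
  then show ?thesis
    by (simp add: s_def)
qed

text \<open>Makes \<open>SNE_eq\<close> available for every tie strength in [0,1], not just for the
  given \<open>w\<close>.\<close>

lemma (in power_control_game) power_control_game_update_tie:
  assumes "t \<in> {0..1}"
  shows "power_control_game h g n c (w(i := (w i)(j := t)))"
  using assms h_pos g_pos n_pos c_pos w_range by unfold_locales auto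

theorem corollary2:
  fixes h n c :: "user \<Rightarrow> real" and g w :: "user \<Rightarrow> user \<Rightarrow> real" and i j :: user
  assumes "power_control_game h g n c w"
    and "i \<noteq> j"
  shows "strict_antimono_on {0..1} (\<lambda>t. SNE h g n c (w(i := (w i)(j := t))) i)"
proof (rule monotone_onI)
  interpret power_control_game h g n c w by fact
  have j: "j = other i"
    using \<open>i \<noteq> j\<close> by (cases i; cases j) simp_all
  have pos: "0 < g i j" "0 < c i" "0 < n j"
    using g_pos c_pos n_pos \<open>i \<noteq> j\<close> by auto
  let ?w = "\<lambda>t. w(i := (w i)(j := t))"
  fix s t :: real
  assume st: "s \<in> {0..1}" "t \<in> {0..1}" "s < t"
  \<comment> \<open>As a function of the tie, \<open>sne_alpha\<close> is affine with slope 1 / (2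
    c_i) > 0.\<close>
  have "sne_alpha g n c (?w s) i < sne_alpha g n c (?w t) i"
    unfolding sne_alpha_def j[symmetric] using pos st(3) by (simp add: divide_strict_right_mono)
  moreover have "0 < sne_beta g n c i"
    unfolding sne_beta_def j[symmetric] using pos by simp
  ultimately have "sne_power g n c (?w t) i < sne_power g n c (?w s) i"
    unfolding sne_power_def by (intro sqrt_square_plus_minus_strict_antimono)
  then show "SNE h g n c (?w t) i < SNE h g n c (?w s) i"
    using st by (simp add: power_control_game.SNE_eq[OF power_control_game_update_tie])
qed

end
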